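(* Let $R$ be a commutative ring with identity $1\neq 0$ and let $I$ be an ideal of $R$. If $\mathrm{diam}(\overline{\Gamma}(R))=3$, then $\mathrm{diam}(\overline{\Gamma}(R\Join I))=3$.
   Context: For a commutative ring $A$ with $1\neq 0$, $Z(A)$ is the set of zero-divisors of $A$ (including $0$) and $Z(A)^*=Z(A)\setminus\{0\}$. The extended zero-divisor graph $\overline{\Gamma}(A)$ is the simple graph with vertex set $Z(A)^*$ in which distinct vertices $x,y$ are adjacent if and only if there exist integers $n,m\geq 1$ with $x^ny^m=0$, $x^n\neq 0$ and $y^m\neq 0$. The distance $d(u,v)$ between two vertices is the length of a shortest path joining them ($\infty$ if there is none), and the diameter $\mathrm{diam}(G)$ of a graph $G$ is the supremum of $d(u,v)$ over all vertices $u,v$. For an ideal $I$ of $R$, the amalgamated duplication of $R$ along $I$ is the subring $R\Join I=\{(r,r+i) : r\in R,\ i\in I\}$ of $R\times R$. *)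

theory Defs
  imports
    "HOL-Algebra.Algebra"
    "HOL-Library.Extended_Nat"
    "Graph_Theory.Graph_Theory"
begin

definition zero_divisors :: "('a, 'm) ring_scheme \<Rightarrow> 'a set" where
  "zero_divisors A =
     {x \<in> carrier A. \<exists>y \<in> carrier A. y \<noteq> \<zero>\<^bsub>A\<^esub> \<and> x \<otimes>\<^bsub>A\<^esub> y = \<zero>\<^bsub>A\<^esub>}"

lemma (in ring) zero_in_zero_divisors:
  "\<one> \<noteq> \<zero> \<Longrightarrow> \<zero> \<in> zero_divisors R"
  unfolding zero_divisors_def by (auto intro!: bexI[of _ \<one>])

definition ext_zd_adj :: "('a, 'm) ring_scheme \<Rightarrow> 'a \<Rightarrow> 'a \<Rightarrow> bool" where
  "ext_zd_adj A x y \<longleftrightarrow> x \<noteq> y \<and>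
     (\<exists>(n::nat) (m::nat). n \<ge> 1 \<and> m \<ge> 1 \<and>
        x [^]\<^bsub>A\<^esub> n \<otimes>\<^bsub>A\<^esub> y [^]\<^bsub>A\<^esub> m = \<zero>\<^bsub>A\<^esub> \<and>
        x [^]\<^bsub>A\<^esub> n \<noteq> \<zero>\<^bsub>A\<^esub> \<and> y [^]\<^bsub>A\<^esub> m \<noteq> \<zero>\<^bsub>A\<^esub>)"

text \<open>A simple graph is a symmetric, loop-free digraph whose arcs are ordered pairs of vertices
  (so that there are no parallel arcs). The graph may be infinite.\<close>

definition ext_zd_graph :: "('a, 'm) ring_scheme \<Rightarrow> 'a pair_pre_digraph" where
  "ext_zd_graph A =
     (let V = zero_divisors A - {\<zero>\<^bsub>A\<^esub>}
      in \<lparr> pverts = V, parcs = {(x, y). x \<in> V \<and> y \<in> V \<and> ext_zd_adj A x y} \<rparr>)"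

lemma wf_ext_zd_graph: "wf_digraph (with_proj (ext_zd_graph A))"
  by unfold_locales (auto simp: ext_zd_graph_def Let_def)

lemma loopfree_ext_zd_graph: "loopfree_digraph (with_proj (ext_zd_graph A))"
  by unfold_locales (auto simp: ext_zd_graph_def Let_def ext_zd_adj_def)

lemma (in cring) symmetric_ext_zd_graph: "symmetric (with_proj (ext_zd_graph R))"
proof -
  have comm: "x [^] n \<otimes> y [^] m = y [^] m \<otimes> x [^] n"
    if "x \<in> carrier R" "y \<in> carrier R" for x y and n m :: nat
    using that by (simp add: m_comm)
  have "ext_zd_adj R y x"
    if "x \<in> carrier R" "y \<in> carrier R" "ext_zd_adj R x y" for x y
    using that(3) comm[OF that(1,2)] unfolding ext_zd_adj_def by metis
  then show ?thesis
    by (auto simp: symmetric_def sym_def ext_zd_graph_def Let_def zero_divisors_def)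
qed

text \<open>The infimum of the empty set in \<^typ>\<open>enat\<close> is \<open>\<infinity>\<close>, so vertices in different components are at
  distance \<open>\<infinity>\<close>. The list of arcs of a path has as its length the length of the path.\<close>

definition graph_dist :: "('a, 'b) pre_digraph \<Rightarrow> 'a \<Rightarrow> 'a \<Rightarrow> enat" where
  "graph_dist G u v = (INF p \<in> {p. pre_digraph.apath G u p v}. enat (length p))"

definition graph_diam :: "('a, 'b) pre_digraph \<Rightarrow> enat" where
  "graph_diam G = (SUP u \<in> verts G. SUP v \<in> verts G. graph_dist G u v)"

definition amalgamated_duplication ::
    "('a, 'm) ring_scheme \<Rightarrow> 'a set \<Rightarrow> ('a \<times> 'a) ring"  (infixl \<open>\<Join>\<close> 70) where
  "R \<Join> I =
     (RDirProd R R)\<lparr>carrier := {(r, r \<oplus>\<^bsub>R\<^esub> i) | r i. r \<in> carrier R \<and> i \<in> I}\<rparr>"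

lemma amalgamated_duplication_simps:
  "carrier (R \<Join> I) = {(r, r \<oplus>\<^bsub>R\<^esub> i) | r i. r \<in> carrier R \<and> i \<in> I}"
  "(a, b) \<otimes>\<^bsub>R \<Join> I\<^esub> (c, d) = (a \<otimes>\<^bsub>R\<^esub> c, b \<otimes>\<^bsub>R\<^esub> d)"
  "(a, b) \<oplus>\<^bsub>R \<Join> I\<^esub> (c, d) = (a \<oplus>\<^bsub>R\<^esub> c, b \<oplus>\<^bsub>R\<^esub> d)"
  "\<one>\<^bsub>R \<Join> I\<^esub> = (\<one>\<^bsub>R\<^esub>, \<one>\<^bsub>R\<^esub>)"
  "\<zero>\<^bsub>R \<Join> I\<^esub> = (\<zero>\<^bsub>R\<^esub>, \<zero>\<^bsub>R\<^esub>)"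
  by (auto simp: amalgamated_duplication_def RDirProd_def DirProd_def monoid.defs)

lemma amalgamated_duplication_cring:
  assumes "cring R" "ideal I R"
  shows "cring (R \<Join> I)"
proof -
  interpret R: cring R by fact
  interpret I: ideal I R by fact
  have sub: "I \<subseteq> carrier R" by (rule I.a_subset)
  have mem: "(a, b) \<in> carrier (R \<Join> I) \<longleftrightarrow> a \<in> carrier R \<and> b \<in> carrier R \<and> b \<ominus>\<^bsub>R\<^esub> a \<in> I" for a b
  proof
    assume "(a, b) \<in> carrier (R \<Join> I)"
    then obtain i where "a \<in> carrier R" "i \<in> I" "b = a \<oplus>\<^bsub>R\<^esub> i"
      by (auto simp: amalgamated_duplication_simps)
    moreover have "(a \<oplus>\<^bsub>R\<^esub> i) \<ominus>\<^bsub>R\<^esub> a = i" if "a \<in> carrier R" "i \<in> carrier R"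
      using that by algebra
    ultimately show "a \<in> carrier R \<and> b \<in> carrier R \<and> b \<ominus>\<^bsub>R\<^esub> a \<in> I" using sub by auto
  next
    assume h: "a \<in> carrier R \<and> b \<in> carrier R \<and> b \<ominus>\<^bsub>R\<^esub> a \<in> I"
    then have "b = a \<oplus>\<^bsub>R\<^esub> (b \<ominus>\<^bsub>R\<^esub> a)" by algebra
    with h show "(a, b) \<in> carrier (R \<Join> I)" by (auto simp: amalgamated_duplication_simps)
  qed
  have add: "(b \<oplus>\<^bsub>R\<^esub> d) \<ominus>\<^bsub>R\<^esub> (a \<oplus>\<^bsub>R\<^esub> c) \<in> I"
    if "a \<in> carrier R" "b \<in> carrier R" "c \<in> carrier R" "d \<in> carrier R"
       "b \<ominus>\<^bsub>R\<^esub> a \<in> I" "d \<ominus>\<^bsub>R\<^esub> c \<in> I" for a b c d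
  proof -
    have "(b \<oplus>\<^bsub>R\<^esub> d) \<ominus>\<^bsub>R\<^esub> (a \<oplus>\<^bsub>R\<^esub> c) = (b \<ominus>\<^bsub>R\<^esub> a) \<oplus>\<^bsub>R\<^esub> (d \<ominus>\<^bsub>R\<^esub> c)"
      using that(1-4) by algebra
    then show ?thesis using that(5,6) by simp
  qed
  have mult: "(b \<otimes>\<^bsub>R\<^esub> d) \<ominus>\<^bsub>R\<^esub> (a \<otimes>\<^bsub>R\<^esub> c) \<in> I"
    if "a \<in> carrier R" "b \<in> carrier R" "c \<in> carrier R" "d \<in> carrier R"
       "b \<ominus>\<^bsub>R\<^esub> a \<in> I" "d \<ominus>\<^bsub>R\<^esub> c \<in> I" for a b c d
  proof -
    have "(b \<otimes>\<^bsub>R\<^esub> d) \<ominus>\<^bsub>R\<^esub> (a \<otimes>\<^bsub>R\<^esub> c) = b \<otimes>\<^bsub>R\<^esub> (d \<ominus>\<^bsub>R\<^esub> c) \<oplus>\<^bsub>R\<^esub> c \<otimes>\<^bsub>R\<^esub> (b \<ominus>\<^bsub>R\<^esub> a)"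
      using that(1-4) by algebra
    then show ?thesis using that by (simp add: I.I_l_closed)
  qed
  have neg: "(\<ominus>\<^bsub>R\<^esub> b) \<ominus>\<^bsub>R\<^esub> (\<ominus>\<^bsub>R\<^esub> a) \<in> I"
    if "a \<in> carrier R" "b \<in> carrier R" "b \<ominus>\<^bsub>R\<^esub> a \<in> I" for a b
  proof -
    have "(\<ominus>\<^bsub>R\<^esub> b) \<ominus>\<^bsub>R\<^esub> (\<ominus>\<^bsub>R\<^esub> a) = \<ominus>\<^bsub>R\<^esub> (b \<ominus>\<^bsub>R\<^esub> a)" using that(1,2) by algebra
    then show ?thesis using that(3) by simp
  qed
  have refl: "a \<ominus>\<^bsub>R\<^esub> a \<in> I" if "a \<in> carrier R" for a
    using that I.zero_closed by (simp add: a_minus_def R.r_neg)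
  show ?thesis
  proof (rule cringI)
    show "abelian_group (R \<Join> I)"
    proof (rule abelian_groupI)
      fix x assume x: "x \<in> carrier (R \<Join> I)"
      obtain a b where ab: "x = (a, b)" by force
      have "(\<ominus>\<^bsub>R\<^esub> a, \<ominus>\<^bsub>R\<^esub> b) \<in> carrier (R \<Join> I)" using x ab neg by (simp add: mem)
      then show "\<exists>y\<in>carrier (R \<Join> I). y \<oplus>\<^bsub>R \<Join> I\<^esub> x = \<zero>\<^bsub>R \<Join> I\<^esub>"
        using x ab by (intro bexI[of _ "(\<ominus>\<^bsub>R\<^esub> a, \<ominus>\<^bsub>R\<^esub> b)"])
          (auto simp: mem amalgamated_duplication_simps(2-) R.l_neg)
    qed (auto simp: mem amalgamated_duplication_simps(2-) add refl R.a_ac)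
    show "comm_monoid (R \<Join> I)"
      by (rule comm_monoidI)
        (auto simp: mem amalgamated_duplication_simps(2-) mult refl R.m_ac)
  qed (auto simp: mem amalgamated_duplication_simps(2-) R.l_distr)
qed

end

theory Submission
  imports Defs
begin

text \<open>In any commutative ring, if \<open>x a = 0 = y b\<close> with \<open>a, b \<noteq> 0\<close>, then \<open>x - ab - y\<close> (if \<open>ab \<noteq> 0\<close>) or
  \<open>x - a - b - y\<close> (if \<open>ab = 0\<close>) is a walk up to repeated vertices, so the diameter is at most 3. For
  the lower bound, take \<open>x, y\<close> at distance 3 in the graph of \<open>R\<close>. A common neighbour \<open>(a, b)\<close> of
  \<open>(x, x)\<close> and \<open>(y, y)\<close> is witnessed by nonzero powers \<open>(a, b)\<^sup>m\<close> and \<open>(a, b)\<^sup>l\<close>. A component whose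
  power with the larger exponent is nonzero has both powers nonzero, so it is a common neighbour
  of \<open>x\<close> and \<open>y\<close>, a contradiction.\<close>

section \<open>Walks, paths and distances in a digraph\<close>

lemma (in wf_digraph) length_awalk_to_apath_le:
  assumes "awalk u p v"
  shows "length (awalk_to_apath p) \<le> length p"
  using assms
proof (induct rule: awalk_to_apath_induct)
  case (path p)
  then have "awalk_to_apath p = p" by (auto simp: awalk_to_apath.simps)
  then show ?case by simp
next
  \<comment> \<open>Here \<open>p\<close> splits as \<open>q @ r @ s\<close> with \<open>r\<close> a
    closed walk; the recursion continues with \<open>q @ s\<close>, so arcs are only
    removed.\<close>
  case (decomp p q r s)
  have "length (awalk_to_apath p) = length (awalk_to_apath (q @ s))"
    using step_awalk_to_apath[OF decomp(1,2,3)] by (rule arg_cong)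
  also have "\<dots> \<le> length (q @ s)" by (rule decomp(4))
  also have "\<dots> \<le> length p"
    using awalk_cyc_decomp_has_prop[OF decomp(1,3)] decomp(2) by simp
  finally show ?case .
qed

text \<open>The order on \<open>enat\<close> is a well-order, so the infimum is a least element.
  Hence a finite distance is realised by an actual path.\<close>

lemma Inf_enat_mem:
  fixes A :: "enat set"
  assumes "A \<noteq> {}"
  shows "Inf A \<in> A"
  using assms by (auto simp: Inf_enat_def intro: LeastI)

text \<open>Replaces paths by walks, so that walks can later be concatenated without checking for
  repeated vertices. A finite infimum is attained by a path, and pruning a walk to a path does not
  lengthen it.\<close>

lemma (in wf_digraph) graph_dist_le_iff:
  "graph_dist G u v \<le> enat n \<longleftrightarrow> (\<exists>p. awalk u p v \<and> length p \<le> n)"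
proof
  let ?P = "{p. apath u p v}"
  assume le: "graph_dist G u v \<le> enat n"
  have "?P \<noteq> {}"
  proof
    assume "?P = {}"
    then have "graph_dist G u v = \<infinity>"
      unfolding graph_dist_def by (simp only: image_empty Inf_empty top_enat_def)
    with le show False by simp
  qed
  then have "graph_dist G u v \<in> (\<lambda>p. enat (length p)) ` ?P"
    unfolding graph_dist_def by - (rule Inf_enat_mem, blast)
  then obtain p where "apath u p v" "graph_dist G u v = enat (length p)" by blast
  with le show "\<exists>p. awalk u p v \<and> length p \<le> n"
    by (metis awalkI_apath enat_ord_simps(1))
next
  assume "\<exists>p. awalk u p v \<and> length p \<le> n"
  then obtain p where p: "awalk u p v" "length p \<le> n" by blast
  have "graph_dist G u v \<le> enat (length (awalk_to_apath p))"
    unfolding graph_dist_def by (rule INF_lower) (simp add: apath_awalk_to_apath[OF p(1)])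
  also have "\<dots> \<le> enat n"
    using length_awalk_to_apath_le[OF p(1)] p(2) by simp
  finally show "graph_dist G u v \<le> enat n" .
qed

section \<open>Short walks and the diameter of the extended zero-divisor graph\<close>

abbreviation nonzero_zero_divisors :: "('a, 'm) ring_scheme \<Rightarrow> 'a set" where
  "nonzero_zero_divisors A \<equiv> zero_divisors A - {\<zero>\<^bsub>A\<^esub>}"

lemma pverts_ext_zd_graph: "pverts (ext_zd_graph A) = nonzero_zero_divisors A"
  by (simp add: ext_zd_graph_def Let_def)

lemma parcs_ext_zd_graph:
  "(x, y) \<in> parcs (ext_zd_graph A) \<longleftrightarrow>
     x \<in> nonzero_zero_divisors A \<and> y \<in> nonzero_zero_divisors A \<and> ext_zd_adj A x y"
  by (simp add: ext_zd_graph_def Let_def)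

context
  fixes A :: "('a, 'm) ring_scheme"
begin

interpretation wf_digraph "with_proj (ext_zd_graph A)" by (rule wf_ext_zd_graph)

lemma awalk_ext_zd_Cons:
  "awalk u (e # p) v \<longleftrightarrow>
     u \<in> nonzero_zero_divisors A \<and> fst e = u \<and> snd e \<in> nonzero_zero_divisors A \<and>
     ext_zd_adj A u (snd e) \<and> awalk (snd e) p v"
  by (cases e) (auto simp: awalk_Cons_iff parcs_ext_zd_graph)

lemma awalk_ext_zd_Nil: "awalk u [] v \<longleftrightarrow> u = v \<and> u \<in> nonzero_zero_divisors A"
  by (auto simp: awalk_Nil_iff pverts_ext_zd_graph)

lemma ext_zd_dist_le_2_iff:
  "graph_dist (with_proj (ext_zd_graph A)) u v \<le> 2 \<longleftrightarrow>
     u \<in> nonzero_zero_divisors A \<and> v \<in> nonzero_zero_divisors A \<and>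
     (u = v \<or> ext_zd_adj A u v \<or>
      (\<exists>w \<in> nonzero_zero_divisors A. ext_zd_adj A u w \<and> ext_zd_adj A w v))"
  (is "?L \<longleftrightarrow> ?R")
proof -
  have "?L \<longleftrightarrow> (\<exists>p. awalk u p v \<and> length p \<le> 2)"
    using graph_dist_le_iff[of u v 2] by (simp only: numeral_eq_enat)
  also have "\<dots> \<longleftrightarrow> ?R"
  proof
    assume "\<exists>p. awalk u p v \<and> length p \<le> 2"
    then obtain p where p: "awalk u p v" "length p \<le> 2" by blast
    then show ?R
    \<comment> \<open>This rule serves only for its case split: empty list, singleton, at least two
      entries.\<close>
    proof (cases p rule: remdups_adj.cases)
      case (3 e f q)
      with p(2) have "q = []" by simp
      with 3 p(1) have "awalk u [e, f] v" by (simp only:)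
      then show ?thesis unfolding awalk_ext_zd_Nil awalk_ext_zd_Cons by blast
    qed (auto simp: awalk_ext_zd_Nil awalk_ext_zd_Cons)
  next
    assume ?R
    then consider "awalk u [] v" | "awalk u [(u, v)] v" | w where "awalk u [(u, w), (w, v)] v"
      unfolding awalk_ext_zd_Nil awalk_ext_zd_Cons fst_conv snd_conv by blast
    then show "\<exists>p. awalk u p v \<and> length p \<le> 2"
    proof cases
      case 1
      then show ?thesis by (intro exI[of _ "[]"]) simp
    next
      case 2
      then show ?thesis by (intro exI[of _ "[(u, v)]"]) simp
    next
      case 3
      then show ?thesis by (intro exI[of _ "[(u, w), (w, v)]"]) simp
    qed
  qed
  finally show ?thesis .
qed

text \<open>Exponents 1 and 1 witness an arc, unless \<open>u = v\<close>, as may happen when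
  \<open>u\<close> squares to zero; then the empty walk is used. The bound 1 covers both
  cases.\<close>

lemma awalk_of_mult_zero:
  assumes "u \<in> nonzero_zero_divisors A" "v \<in> nonzero_zero_divisors A" "u \<otimes>\<^bsub>A\<^esub> v = \<zero>\<^bsub>A\<^esub>" "cring A"
  shows "\<exists>p. awalk u p v \<and> length p \<le> 1"
proof (cases "u = v")
  case True
  with assms show ?thesis by (intro exI[of _ "[]"]) (simp add: awalk_ext_zd_Nil)
next
  case False
  interpret A: cring A by fact
  have "ext_zd_adj A u v"
    unfolding ext_zd_adj_def using assms False
    by (intro conjI exI[of _ 1]) (auto simp: zero_divisors_def)
  with assms show ?thesis
    by (intro exI[of _ "[(u, v)]"]) (simp add: awalk_ext_zd_Nil awalk_ext_zd_Cons)
qed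

lemma ext_zd_dist_le_3:
  assumes "cring A" "x \<in> nonzero_zero_divisors A" "y \<in> nonzero_zero_divisors A"
  shows "graph_dist (with_proj (ext_zd_graph A)) x y \<le> 3"
proof -
  interpret A: cring A by fact
  have mul: "c \<in> nonzero_zero_divisors A"
    if "c \<in> carrier A" "d \<in> carrier A" "c \<noteq> \<zero>\<^bsub>A\<^esub>" "d \<noteq> \<zero>\<^bsub>A\<^esub>" "c \<otimes>\<^bsub>A\<^esub> d = \<zero>\<^bsub>A\<^esub>" for c d
    using that by (auto simp: zero_divisors_def)
  from assms obtain a b where
    x: "x \<in> carrier A" "x \<noteq> \<zero>\<^bsub>A\<^esub>" and y: "y \<in> carrier A" "y \<noteq> \<zero>\<^bsub>A\<^esub>"
    and a: "a \<in> carrier A" "a \<noteq> \<zero>\<^bsub>A\<^esub>" "x \<otimes>\<^bsub>A\<^esub> a = \<zero>\<^bsub>A\<^esub>"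
    and b: "b \<in> carrier A" "b \<noteq> \<zero>\<^bsub>A\<^esub>" "y \<otimes>\<^bsub>A\<^esub> b = \<zero>\<^bsub>A\<^esub>"
    by (auto simp: zero_divisors_def)
  have "a \<otimes>\<^bsub>A\<^esub> x = \<zero>\<^bsub>A\<^esub>" and "b \<otimes>\<^bsub>A\<^esub> y = \<zero>\<^bsub>A\<^esub>"
    using a b x y by (simp_all add: A.m_comm)
  \<comment> \<open>The annihilators are vertices themselves, since the nonzero \<open>x\<close>
    kills \<open>a\<close> and the nonzero \<open>y\<close> kills \<open>b\<close>.\<close>
  then have aV: "a \<in> nonzero_zero_divisors A" and bV: "b \<in> nonzero_zero_divisors A"
    using mul[of a x] mul[of b y] a b x y by auto
  note arc = awalk_of_mult_zero[OF _ _ _ \<open>cring A\<close>]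
  have "\<exists>p. awalk x p y \<and> length p \<le> 3"
  proof (cases "a \<otimes>\<^bsub>A\<^esub> b = \<zero>\<^bsub>A\<^esub>")
    case True
    obtain p q r where p: "awalk x p a" "length p \<le> 1" and q: "awalk a q b" "length q \<le> 1"
      and r: "awalk b r y" "length r \<le> 1"
      using arc[OF assms(2) aV a(3)] arc[OF aV bV True] arc[OF bV assms(3) \<open>b \<otimes>\<^bsub>A\<^esub> y = \<zero>\<^bsub>A\<^esub>\<close>]
      by blast
    have "awalk x (p @ q @ r) y"
      by (rule awalk_appendI[OF p(1) awalk_appendI[OF q(1) r(1)]])
    moreover have "length (p @ q @ r) \<le> 3" using p(2) q(2) r(2) by simp
    ultimately show ?thesis by blast
  next
    case False
    have abx: "x \<otimes>\<^bsub>A\<^esub> (a \<otimes>\<^bsub>A\<^esub> b) = \<zero>\<^bsub>A\<^esub>"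
      using a b x by (simp flip: A.m_assoc)
    have aby: "(a \<otimes>\<^bsub>A\<^esub> b) \<otimes>\<^bsub>A\<^esub> y = \<zero>\<^bsub>A\<^esub>"
      using a b y \<open>b \<otimes>\<^bsub>A\<^esub> y = \<zero>\<^bsub>A\<^esub>\<close> by (simp add: A.m_assoc)
    have abV: "a \<otimes>\<^bsub>A\<^esub> b \<in> nonzero_zero_divisors A"
      using mul[of "a \<otimes>\<^bsub>A\<^esub> b" y] a b y aby False by auto
    obtain p q where p: "awalk x p (a \<otimes>\<^bsub>A\<^esub> b)" "length p \<le> 1"
      and q: "awalk (a \<otimes>\<^bsub>A\<^esub> b) q y" "length q \<le> 1"
      using arc[OF assms(2) abV abx] arc[OF abV assms(3) aby] by blast
    have "awalk x (p @ q) y" by (rule awalk_appendI[OF p(1) q(1)])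
    moreover have "length (p @ q) \<le> 3" using p(2) q(2) by simp
    ultimately show ?thesis by blast
  qed
  then show ?thesis
    using graph_dist_le_iff[of x y 3] by (simp only: numeral_eq_enat)
qed

text \<open>The diameter is always at most 3, and \<open>enat\<close> has no value strictly between
  2 and 3, so it equals 3 as soon as one pair of vertices is more than 2 apart. With no vertices the
  supremum is 0 and both sides fail.\<close>

lemma ext_zd_diam_eq_3_iff:
  assumes "cring A"
  shows "graph_diam (with_proj (ext_zd_graph A)) = 3 \<longleftrightarrow>
    (\<exists>x \<in> nonzero_zero_divisors A. \<exists>y \<in> nonzero_zero_divisors A.
      \<not> graph_dist (with_proj (ext_zd_graph A)) x y \<le> 2)"
    (is "?diam = 3 \<longleftrightarrow> ?R")
proof -
  have "?diam \<le> 3"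
    unfolding graph_diam_def with_proj_simps pverts_ext_zd_graph
    by (intro SUP_least ext_zd_dist_le_3[OF assms])
  then have "?diam = 3 \<longleftrightarrow> \<not> ?diam \<le> 2"
    by (cases ?diam) (simp_all only: numeral_eq_enat enat_ord_simps enat.inject, auto)
  also have "?diam \<le> 2 \<longleftrightarrow> \<not> ?R"
    by (auto simp: graph_diam_def with_proj_simps pverts_ext_zd_graph SUP_le_iff)
  finally show ?thesis by simp
qed

end

section \<open>Powers and annihilation in commutative rings\<close>

lemma (in cring) zero_divisor_of_pow_mult_eq_zero:
  assumes "x \<in> carrier R" "a \<in> carrier R" "x [^] (n::nat) \<otimes> a [^] (m::nat) = \<zero>" "x [^] n \<noteq> \<zero>"
  shows "a \<in> zero_divisors R"
  using assms(3)
proof (induction m)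
  case 0
  with assms show ?case by simp
next
  \<comment> \<open>Descend to the least exponent of \<open>a\<close> for which the product
    vanishes: the product with one factor \<open>a\<close> fewer is nonzero and killed by
    \<open>a\<close>. Exponent 0 cannot occur, as it would give
    \<open>x [^] n = \<zero>\<close>.\<close>
  case (Suc m)
  show ?case
  proof (cases "x [^] n \<otimes> a [^] m = \<zero>")
    case False
    have "a \<otimes> (x [^] n \<otimes> a [^] m) = \<zero>"
      using Suc.prems assms(1,2) by (simp add: m_ac)
    with False assms(1,2) show ?thesis by (auto simp: zero_divisors_def)
  qed (rule Suc.IH)
qed

text \<open>\<open>a [^] m\<close> is a factor of \<open>a [^] l\<close>.\<close>

lemma (in cring) nat_pow_neq_zero_mono:
  assumes "a \<in> carrier R" "a [^] (l::nat) \<noteq> \<zero>" "m \<le> l"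
  shows "a [^] m \<noteq> \<zero>"
  using assms nat_pow_mult[of a m "l - m"] by force

lemma nat_pow_duplication:
  fixes n :: nat
  shows "(a, b) [^]\<^bsub>R \<Join> I\<^esub> n = (a [^]\<^bsub>R\<^esub> n, b [^]\<^bsub>R\<^esub> n)"
  by (induction n) (simp_all add: amalgamated_duplication_simps nat_pow_def)

theorem proposition3p6:
  fixes R :: "('a, 'm) ring_scheme" and I :: "'a set"
  assumes "cring R"
    and "\<one>\<^bsub>R\<^esub> \<noteq> \<zero>\<^bsub>R\<^esub>"
    and "ideal I R"
    and "graph_diam (with_proj (ext_zd_graph R)) = 3"
  shows "graph_diam (with_proj (ext_zd_graph (R \<Join> I))) = 3"
proof -
  interpret R: cring R by fact
  interpret I: ideal I R by fact
  interpret D: cring "R \<Join> I" by (rule amalgamated_duplication_cring[OF assms(1,3)])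
  let ?V = "nonzero_zero_divisors R"
  note dup = amalgamated_duplication_simps nat_pow_duplication
  have carrierD: "a \<in> carrier R \<and> b \<in> carrier R" if "(a, b) \<in> carrier (R \<Join> I)" for a b
    using that I.a_subset by (auto simp: dup)
  have diag: "(x, x) \<in> carrier (R \<Join> I)" if "x \<in> carrier R" for x
    unfolding dup(1) using that I.zero_closed
    by (intro CollectI exI[of _ x] exI[of _ "\<zero>\<^bsub>R\<^esub>"] conjI) simp_all
  have diagV: "(x, x) \<in> nonzero_zero_divisors (R \<Join> I)" if x: "x \<in> ?V" for x
  proof -
    from x obtain z where xz: "x \<in> carrier R" "z \<in> carrier R" "z \<noteq> \<zero>\<^bsub>R\<^esub>" "x \<otimes>\<^bsub>R\<^esub> z = \<zero>\<^bsub>R\<^esub>"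
      unfolding zero_divisors_def by blast
    then have "(x, x) \<otimes>\<^bsub>R \<Join> I\<^esub> (z, z) = \<zero>\<^bsub>R \<Join> I\<^esub>" "(z, z) \<noteq> \<zero>\<^bsub>R \<Join> I\<^esub>"
      unfolding dup(2-) prod.inject by blast+
    with xz(1,2) have "(x, x) \<in> zero_divisors (R \<Join> I)"
      unfolding zero_divisors_def using diag by blast
    moreover have "(x, x) \<noteq> \<zero>\<^bsub>R \<Join> I\<^esub>"
      using x unfolding dup(2-) prod.inject by blast
    ultimately show ?thesis by blast
  qed
  from assms(4) obtain x y where V: "x \<in> ?V" "y \<in> ?V"
    and "\<not> graph_dist (with_proj (ext_zd_graph R)) x y \<le> 2"
    unfolding ext_zd_diam_eq_3_iff[OF assms(1)] by blast
  then have neq: "x \<noteq> y" and nadj: "\<not> ext_zd_adj R x y"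
    and far: "\<And>a. a \<in> ?V \<Longrightarrow> ext_zd_adj R x a \<Longrightarrow> ext_zd_adj R a y \<Longrightarrow> False"
    unfolding ext_zd_dist_le_2_iff by blast+
  have carr: "x \<in> carrier R" "y \<in> carrier R" using V unfolding zero_divisors_def by blast+
  \<comment> \<open>The two relations may use different exponents \<open>m\<close> and
    \<open>l\<close> of \<open>a\<close>; what matters is that both powers are nonzero.\<close>
  have no_common: False
    if a: "a \<in> carrier R" and exps: "n \<ge> 1" "m \<ge> 1" "l \<ge> 1" "k \<ge> 1"
      and xa: "x [^]\<^bsub>R\<^esub> n \<otimes>\<^bsub>R\<^esub> a [^]\<^bsub>R\<^esub> m = \<zero>\<^bsub>R\<^esub>" "x [^]\<^bsub>R\<^esub> n \<noteq> \<zero>\<^bsub>R\<^esub>" "a [^]\<^bsub>R\<^esub> m \<noteq> \<zero>\<^bsub>R\<^esub>"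
      and ay: "a [^]\<^bsub>R\<^esub> l \<otimes>\<^bsub>R\<^esub> y [^]\<^bsub>R\<^esub> k = \<zero>\<^bsub>R\<^esub>" "a [^]\<^bsub>R\<^esub> l \<noteq> \<zero>\<^bsub>R\<^esub>" "y [^]\<^bsub>R\<^esub> k \<noteq> \<zero>\<^bsub>R\<^esub>"
    for a and n m l k :: nat
  proof -
    \<comment> \<open>If \<open>a = x\<close>, the relation between \<open>a\<close> and
      \<open>y\<close> would make \<open>x\<close> and \<open>y\<close> adjacent; if
      \<open>a = y\<close>, the relation between \<open>x\<close> and \<open>a\<close>
      would.\<close>
    have "a \<noteq> x" "a \<noteq> y"
      using nadj neq exps xa ay unfolding ext_zd_adj_def by blast+
    then have "ext_zd_adj R x a" "ext_zd_adj R a y"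
      using exps xa ay unfolding ext_zd_adj_def by blast+
    \<comment> \<open>That \<open>a\<close> is nonzero follows from \<open>a [^] m\<close> being
      nonzero and 1 \<le> \<open>m\<close>, by comparison with the first power.\<close>
    moreover have "a \<in> ?V"
      using R.zero_divisor_of_pow_mult_eq_zero[OF carr(1) a xa(1,2)]
        R.nat_pow_neq_zero_mono[OF a xa(3) exps(2)] a
      by simp
    ultimately show False using far by blast
  qed
  \<comment> \<open>Powers and products are componentwise, so an arc between diagonal elements would
    descend to \<open>R\<close> with the same exponents.\<close>
  have "\<not> ext_zd_adj (R \<Join> I) (x, x) (y, y)"
    using nadj neq unfolding ext_zd_adj_def dup(2-) prod.inject by blast
  moreover have False
    if w: "w \<in> nonzero_zero_divisors (R \<Join> I)"
      and xw: "ext_zd_adj (R \<Join> I) (x, x) w" and wy: "ext_zd_adj (R \<Join> I) w (y, y)" for w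
  proof -
    obtain a b where ab: "w = (a, b)" by force
    with w carrierD have a: "a \<in> carrier R" and b: "b \<in> carrier R"
      unfolding zero_divisors_def by blast+
    from xw obtain n m :: nat where nm: "n \<ge> 1" "m \<ge> 1" and
      "(x, x) [^]\<^bsub>R \<Join> I\<^esub> n \<otimes>\<^bsub>R \<Join> I\<^esub> w [^]\<^bsub>R \<Join> I\<^esub> m = \<zero>\<^bsub>R \<Join> I\<^esub>"
      "(x, x) [^]\<^bsub>R \<Join> I\<^esub> n \<noteq> \<zero>\<^bsub>R \<Join> I\<^esub>" "w [^]\<^bsub>R \<Join> I\<^esub> m \<noteq> \<zero>\<^bsub>R \<Join> I\<^esub>"
      unfolding ext_zd_adj_def by blast
    \<comment> \<open>A vanishing product vanishes in both components, but a nonzero pair has only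
      some nonzero component. For the diagonal element this still gives \<open>x [^] n\<close>
      nonzero; for \<open>w\<close> it leaves a disjunction.\<close>
    then have xab: "x [^]\<^bsub>R\<^esub> n \<noteq> \<zero>\<^bsub>R\<^esub>"
      "x [^]\<^bsub>R\<^esub> n \<otimes>\<^bsub>R\<^esub> a [^]\<^bsub>R\<^esub> m = \<zero>\<^bsub>R\<^esub>" "x [^]\<^bsub>R\<^esub> n \<otimes>\<^bsub>R\<^esub> b [^]\<^bsub>R\<^esub> m = \<zero>\<^bsub>R\<^esub>"
      "a [^]\<^bsub>R\<^esub> m \<noteq> \<zero>\<^bsub>R\<^esub> \<or> b [^]\<^bsub>R\<^esub> m \<noteq> \<zero>\<^bsub>R\<^esub>"
      unfolding ab dup(2-) prod.inject by blast+
    from wy obtain l k :: nat where lk: "l \<ge> 1" "k \<ge> 1" and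
      "w [^]\<^bsub>R \<Join> I\<^esub> l \<otimes>\<^bsub>R \<Join> I\<^esub> (y, y) [^]\<^bsub>R \<Join> I\<^esub> k = \<zero>\<^bsub>R \<Join> I\<^esub>"
      "w [^]\<^bsub>R \<Join> I\<^esub> l \<noteq> \<zero>\<^bsub>R \<Join> I\<^esub>" "(y, y) [^]\<^bsub>R \<Join> I\<^esub> k \<noteq> \<zero>\<^bsub>R \<Join> I\<^esub>"
      unfolding ext_zd_adj_def by blast
    then have yab: "y [^]\<^bsub>R\<^esub> k \<noteq> \<zero>\<^bsub>R\<^esub>"
      "a [^]\<^bsub>R\<^esub> l \<otimes>\<^bsub>R\<^esub> y [^]\<^bsub>R\<^esub> k = \<zero>\<^bsub>R\<^esub>" "b [^]\<^bsub>R\<^esub> l \<otimes>\<^bsub>R\<^esub> y [^]\<^bsub>R\<^esub> k = \<zero>\<^bsub>R\<^esub>"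
      "a [^]\<^bsub>R\<^esub> l \<noteq> \<zero>\<^bsub>R\<^esub> \<or> b [^]\<^bsub>R\<^esub> l \<noteq> \<zero>\<^bsub>R\<^esub>"
      unfolding ab dup(2-) prod.inject by blast+
    have "(a [^]\<^bsub>R\<^esub> m \<noteq> \<zero>\<^bsub>R\<^esub> \<and> a [^]\<^bsub>R\<^esub> l \<noteq> \<zero>\<^bsub>R\<^esub>) \<or> (b [^]\<^bsub>R\<^esub> m \<noteq> \<zero>\<^bsub>R\<^esub> \<and> b [^]\<^bsub>R\<^esub> l \<noteq> \<zero>\<^bsub>R\<^esub>)"
    proof (cases "m \<le> l")
      case True
      show ?thesis
        using yab(4) R.nat_pow_neq_zero_mono[OF a _ True] R.nat_pow_neq_zero_mono[OF b _ True]
        by blast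
    next
      case False
      then have "l \<le> m" by simp
      then show ?thesis
        using xab(4) R.nat_pow_neq_zero_mono[OF a _ \<open>l \<le> m\<close>] R.nat_pow_neq_zero_mono[OF b _ \<open>l \<le> m\<close>]
        by blast
    qed
    then show False
      using no_common[OF a nm lk xab(2,1) _ yab(2) _ yab(1)]
        no_common[OF b nm lk xab(3,1) _ yab(3) _ yab(1)] by blast
  qed
  ultimately have "\<not> graph_dist (with_proj (ext_zd_graph (R \<Join> I))) (x, x) (y, y) \<le> 2"
    using neq unfolding ext_zd_dist_le_2_iff by blast
  then show ?thesis
    unfolding ext_zd_diam_eq_3_iff[OF D.cring_axioms] using diagV V by blast
qed

end
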